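(* Let $1\le N<M$ and let $H_0$ be a self-adjoint operator on $\mathcal{H}_N=\Lambda^N\mathbb{C}^M$. For every $\rho\in\mathcal{P}_{M,N}^+$ there is a $v\in\mathbb{R}^M$ such that the Hamiltonian $H_0+V$ has a ground-state ensemble $\Gamma$ with density $\rho$.
   Context: $\mathcal{P}_{M,N}^+=\{\rho\in\mathbb{R}^M\mid 0<\rho_i<1\text{ for all }i,\ \sum_{i=1}^M\rho_i=N\}$. $\mathcal{H}_N=\Lambda^N\mathbb{C}^M$ has orthonormal basis $e_I=e_{i_1}\wedge\dots\wedge e_{i_N}$ indexed by ordered multi-indices $I=(i_1<\dots<i_N)$ in $\{1,\dots,M\}$; $\hat a_i^\dagger,\hat a_i$ are the fermionic creation/annihilation operators, so $\hat a_i^\dagger\hat a_ie_I=e_I$ if $i\in I$ and $0$ otherwise. A potential $v\in\mathbb{R}^M$ acts as $V=\sum_iv_i\hat a_i^\dagger\hat a_i$. A ground-state ensemble of $H_0+V$ is a positive semidefinite operator $\Gamma$ on $\mathcal{H}_N$ of trace one such that $\mathrm{Tr}(\Gamma(H_0+V))$ equals the smallest eigenvalue of $H_0+V$; its density is $\rho_i=\mathrm{Tr}(\Gamma\hat a_i^\dagger\hat a_i)$. *)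

theory Defs
  imports "HOL-Analysis.Analysis"
begin

text \<open>
  The one-particle space \<open>\<complex>\<^sup>M\<close> is indexed by a finite linearly ordered type \<open>'m\<close> with
  \<open>M = CARD('m)\<close>. An ordered multi-index \<open>i\<^sub>1 < \<dots> < i\<^sub>N\<close> is identified with the set
  \<open>{i\<^sub>1, \<dots>, i\<^sub>N}\<close>, so the full exterior algebra (Fock space) is \<open>complex ^ ('m set)\<close>,
  and \<open>\<Lambda>\<^sup>N\<complex>\<^sup>M\<close> is the subspace of vectors supported on the index sets with \<open>N\<close> elements.
\<close>

type_synonym 'm fock = "complex ^ ('m set)"

definition slater :: "'m::finite set \<Rightarrow> 'm fock"
  where "slater I = axis I 1"

definition sector :: "nat \<Rightarrow> 'm::finite fock set"
  where "sector N = {\<psi>. \<forall>I. card I \<noteq> N \<longrightarrow> \<psi> $ I = 0}"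

definition fock_inner :: "'m::finite fock \<Rightarrow> 'm fock \<Rightarrow> complex"
  where "fock_inner \<phi> \<psi> = (\<Sum>I\<in>UNIV. cnj (\<phi> $ I) * \<psi> $ I)"

text \<open>
  The sign picked up when moving \<open>e\<^sub>i\<close> past the factors of \<open>e\<^sub>I\<close> preceding it. Thus
  \<open>create i\<close> is \<open>e\<^sub>i \<and> _\<close>, and \<open>annihilate i\<close> is its adjoint; see the lemmas below.
\<close>

definition wedge_sign :: "'m::{finite,linorder} \<Rightarrow> 'm set \<Rightarrow> complex"
  where "wedge_sign i I = (-1) ^ card {j \<in> I. j < i}"

definition create :: "'m::{finite,linorder} \<Rightarrow> 'm fock \<Rightarrow> 'm fock"
  where "create i \<psi> = (\<chi> I. if i \<in> I then wedge_sign i I * \<psi> $ (I - {i}) else 0)"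

definition annihilate :: "'m::{finite,linorder} \<Rightarrow> 'm fock \<Rightarrow> 'm fock"
  where "annihilate i \<psi> = (\<chi> I. if i \<in> I then 0 else wedge_sign i I * \<psi> $ insert i I)"

definition number_op :: "'m::{finite,linorder} \<Rightarrow> 'm fock \<Rightarrow> 'm fock"
  where "number_op i = create i \<circ> annihilate i"

definition potential :: "real ^ 'm::{finite,linorder} \<Rightarrow> 'm fock \<Rightarrow> 'm fock"
  where "potential v \<psi> = (\<Sum>i\<in>UNIV. complex_of_real (v $ i) *s number_op i \<psi>)"

lemma wedge_sign_square [simp]: "wedge_sign i I * wedge_sign i I = 1"
  by (simp add: wedge_sign_def flip: power_mult_distrib)

lemma wedge_sign_self [simp]:
  "wedge_sign i (insert i I) = wedge_sign i I" "wedge_sign i (I - {i}) = wedge_sign i I"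
  unfolding wedge_sign_def by (rule arg_cong[where f = "\<lambda>A. (-1) ^ card A"]; auto)+

lemma wedge_sign_insert:
  assumes "j \<notin> I"
  shows "wedge_sign i (insert j I) = (if j < i then - wedge_sign i I else wedge_sign i I)"
proof (cases "j < i")
  case True
  then have "{k \<in> insert j I. k < i} = insert j {k \<in> I. k < i}"
    by auto
  then show ?thesis
    using True assms by (simp add: wedge_sign_def)
next
  case False
  then have "{k \<in> insert j I. k < i} = {k \<in> I. k < i}"
    by auto
  then show ?thesis
    using False by (simp add: wedge_sign_def)
qed

lemma number_op_nth: "number_op i \<psi> $ I = (if i \<in> I then \<psi> $ I else 0)"
  by (simp add: number_op_def create_def annihilate_def insert_absorb flip: mult.assoc)

lemma number_op_slater: "number_op i (slater I) = (if i \<in> I then slater I else 0)"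
  by (auto simp: vec_eq_iff number_op_nth slater_def axis_def)

lemma create_slater:
  "create i (slater I) = (if i \<in> I then 0 else wedge_sign i I *s slater (insert i I))"
  by (auto simp: vec_eq_iff create_def slater_def axis_def)

lemma slater_eq_create:
  assumes "sorted xs" "distinct xs"
  shows "slater (set xs) = foldr create xs (slater {})"
  using assms
proof (induction xs)
  case (Cons i xs)
  have "{j \<in> set xs. j < i} = {}"
    using Cons.prems by auto
  then have "wedge_sign i (set xs) = 1"
    unfolding wedge_sign_def by (simp only: card.empty power_0)
  then show ?case
    using Cons by (simp add: create_slater flip: Cons.IH)
qed simp

lemma annihilate_adjoint: "fock_inner \<phi> (create i \<psi>) = fock_inner (annihilate i \<phi>) \<psi>"
proof -
  have "fock_inner \<phi> (create i \<psi>)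
      = (\<Sum>I\<in>{I. i \<in> I}. cnj (\<phi> $ I) * (wedge_sign i I * \<psi> $ (I - {i})))"
    unfolding fock_inner_def create_def by (rule sum.mono_neutral_cong_right) auto
  also have "\<dots> = (\<Sum>I\<in>{I. i \<notin> I}. wedge_sign i I * cnj (\<phi> $ insert i I) * \<psi> $ I)"
    by (rule sum.reindex_bij_witness[where i = "insert i" and j = "\<lambda>I. I - {i}"])
      (auto simp: insert_absorb)
  also have "\<dots> = fock_inner (annihilate i \<phi>) \<psi>"
    unfolding fock_inner_def annihilate_def
    by (rule sum.mono_neutral_cong_left) (auto simp: wedge_sign_def)
  finally show ?thesis .
qed

lemma create_anticommute: "create i (create j \<psi>) = - create j (create i \<psi>)"
proof (cases "i = j")
  case True
  then show ?thesis
    by (simp add: vec_eq_iff create_def)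
next
  case False
  have "create i (create j \<psi>) $ I = - create j (create i \<psi>) $ I" for I
  proof (cases "i \<in> I \<and> j \<in> I")
    case True
    have drop: "wedge_sign b I = (if a < b then - wedge_sign b (I - {a}) else wedge_sign b (I - {a}))"
      if "a \<in> I" for a b
      using wedge_sign_insert[of a "I - {a}" b] that by (metis Diff_iff insert_Diff singletonI)
    have "wedge_sign i I * wedge_sign j (I - {i}) = - (wedge_sign j I * wedge_sign i (I - {j}))"
      unfolding drop[OF True[THEN conjunct1], of j] drop[OF True[THEN conjunct2], of i]
      using False by (cases "i < j") simp_all
    moreover have "I - {i} - {j} = I - {j} - {i}"
      by auto
    ultimately show ?thesis
      using False True by (simp add: create_def flip: mult.assoc)
  qed (auto simp: create_def)
  then show ?thesis
    by (simp add: vec_eq_iff)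
qed

text \<open>
  Operators on \<open>sector N\<close> are represented by functions on the Fock space, of which only the
  values on \<open>sector N\<close> matter.
\<close>

definition operator_on :: "nat \<Rightarrow> ('m::finite fock \<Rightarrow> 'm fock) \<Rightarrow> bool"
  where "operator_on N A \<longleftrightarrow>
    A ` sector N \<subseteq> sector N \<and>
    (\<forall>\<phi>\<in>sector N. \<forall>\<psi>\<in>sector N. A (\<phi> + \<psi>) = A \<phi> + A \<psi>) \<and>
    (\<forall>c. \<forall>\<psi>\<in>sector N. A (c *s \<psi>) = c *s A \<psi>)"

definition selfadjoint_on :: "nat \<Rightarrow> ('m::finite fock \<Rightarrow> 'm fock) \<Rightarrow> bool"
  where "selfadjoint_on N A \<longleftrightarrow>
    operator_on N A \<and>
    (\<forall>\<phi>\<in>sector N. \<forall>\<psi>\<in>sector N. fock_inner \<phi> (A \<psi>) = fock_inner (A \<phi>) \<psi>)"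

definition positive_on :: "nat \<Rightarrow> ('m::finite fock \<Rightarrow> 'm fock) \<Rightarrow> bool"
  where "positive_on N A \<longleftrightarrow>
    selfadjoint_on N A \<and> (\<forall>\<psi>\<in>sector N. 0 \<le> Re (fock_inner \<psi> (A \<psi>)))"

definition trace_on :: "nat \<Rightarrow> ('m::finite fock \<Rightarrow> 'm fock) \<Rightarrow> complex"
  where "trace_on N A = (\<Sum>I | card I = N. fock_inner (slater I) (A (slater I)))"

definition eigenvalue_on :: "nat \<Rightarrow> ('m::finite fock \<Rightarrow> 'm fock) \<Rightarrow> complex \<Rightarrow> bool"
  where "eigenvalue_on N A \<mu> \<longleftrightarrow> (\<exists>\<psi>\<in>sector N. \<psi> \<noteq> 0 \<and> A \<psi> = \<mu> *s \<psi>)"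

text \<open>Only used for self-adjoint operators, all of whose eigenvalues are real.\<close>

definition smallest_eigenvalue_on :: "nat \<Rightarrow> ('m::finite fock \<Rightarrow> 'm fock) \<Rightarrow> real \<Rightarrow> bool"
  where "smallest_eigenvalue_on N A E \<longleftrightarrow>
    eigenvalue_on N A (complex_of_real E) \<and>
    (\<forall>\<mu>. eigenvalue_on N A (complex_of_real \<mu>) \<longrightarrow> E \<le> \<mu>)"

definition ground_state_ensemble ::
    "nat \<Rightarrow> ('m::finite fock \<Rightarrow> 'm fock) \<Rightarrow> ('m fock \<Rightarrow> 'm fock) \<Rightarrow> bool"
  where "ground_state_ensemble N H \<Gamma> \<longleftrightarrow>
    positive_on N \<Gamma> \<and> trace_on N \<Gamma> = 1 \<and>
    (\<exists>E. smallest_eigenvalue_on N H E \<and> trace_on N (\<Gamma> \<circ> H) = complex_of_real E)"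

definition has_density ::
    "nat \<Rightarrow> ('m::{finite,linorder} fock \<Rightarrow> 'm fock) \<Rightarrow> real ^ 'm::{finite,linorder} \<Rightarrow> bool"
  where "has_density N \<Gamma> \<rho> \<longleftrightarrow>
    (\<forall>i. trace_on N (\<Gamma> \<circ> number_op i) = complex_of_real (\<rho> $ i))"

definition positive_densities :: "nat \<Rightarrow> (real ^ 'm::finite) set"
  where "positive_densities N =
    {\<rho>. (\<forall>i. 0 < \<rho> $ i \<and> \<rho> $ i < 1) \<and> (\<Sum>i\<in>UNIV. \<rho> $ i) = real N}"

end

theory Submission
  imports Defs
begin

text \<open>
  Every unit vector \<open>\<psi>\<close> of the sector gives a point (density of \<open>\<psi>\<close>, energy of \<open>\<psi>\<close> under
  \<open>H\<^sub>0\<close>) of \<open>\<real>\<^sup>M \<times> \<real>\<close>; the convex hull \<open>S\<close> of these points is compact and consists of the pairs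
  realised by ensembles. The concave function
  \<open>G v = min {y + v \<bullet> (x - \<rho>) | (x, y) \<in> S}\<close> is invariant under constant shifts of \<open>v\<close>. Since
  \<open>0 < \<rho>\<^sub>i < 1\<close>, testing with the Slater state of the \<open>N\<close> lowest sites shows that it is coercive
  modulo such shifts, so it has a maximiser \<open>v\<close>. If \<open>(\<rho>, G v)\<close> were outside \<open>S\<close>, a hyperplane
  separating it from \<open>S\<close> would yield a potential with a larger value of \<open>G\<close>. Hence an
  ensemble has density \<open>\<rho>\<close> and minimal energy for \<open>H\<^sub>0 + V\<close>.
\<close>

section \<open>Maximising the dual functional\<close>

text \<open>Filling the \<open>N\<close> lowest sites saves potential energy compared with
  \<open>\<rho>\<close>. Both densities have the same total, so \<open>v\<close> may be measured
  from the top filled level \<open>t\<close>; then every site contributes a nonnegative amount, at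
  least \<open>\<delta>\<close> times its distance from \<open>t\<close>.\<close>

lemma lowest_sites_gap:
  fixes v \<rho> :: "real ^ 'm::finite"
  assumes "1 \<le> N" "N \<le> CARD('m)" and sum: "(\<Sum>i\<in>UNIV. \<rho> $ i) = real N"
    and \<delta>: "0 \<le> \<delta>" "\<And>i. \<delta> \<le> \<rho> $ i" "\<And>i. \<delta> \<le> 1 - \<rho> $ i"
  shows "\<exists>I t. card I = N \<and> (\<forall>j. \<delta> * \<bar>v $ j - t\<bar> \<le> v \<bullet> (\<rho> - (\<chi> i. of_bool (i \<in> I))))"
proof -
  obtain I0 :: "'m set" where "card I0 = N"
    using obtain_subset_with_card_n[OF assms(2)] by blast
  then have ne: "{I :: 'm set. card I = N} \<noteq> {}"
    by auto
  obtain I where I: "card I = N" and min: "\<And>J. card J = N \<Longrightarrow> sum (($) v) I \<le> sum (($) v) J"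
    using ex_min_if_finite[of "sum (($) v) ` {I. card I = N}"] ne
    by (metis (mono_tags, lifting) arg_min_if_finite(1,2) finite mem_Collect_eq not_le)
  have Ine: "I \<noteq> {}"
    using I assms(1) by auto
  \<comment> \<open>Swapping a filled site for an empty one keeps the cardinality, so it cannot
    lower the minimal sum.\<close>
  have exchange: "v $ i \<le> v $ j" if "i \<in> I" "j \<notin> I" for i j
  proof -
    have "card (insert j (I - {i})) = N"
      using that I assms(1) by (simp add: card.insert_remove card_Diff_singleton)
    from min[OF this] show ?thesis
      using that by (simp add: sum_diff1)
  qed
  define t where "t = Max ((($) v) ` I)"
  have t_in: "v $ i \<le> t" if "i \<in> I" for i
    unfolding t_def using that by simp
  have "t \<in> (($) v) ` I"
    unfolding t_def using Ine by (intro Max_in) auto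
  then have t_out: "t \<le> v $ j" if "j \<notin> I" for j
    using exchange that by auto
  have zero: "(\<Sum>i\<in>UNIV. \<rho> $ i - of_bool (i \<in> I)) = 0"
    using I sum by (simp add: sum_subtractf of_bool_def sum.If_cases)
  have "v \<bullet> (\<rho> - (\<chi> i. of_bool (i \<in> I))) = (\<Sum>i\<in>UNIV. v $ i * (\<rho> $ i - of_bool (i \<in> I)))"
    by (simp add: inner_vec_def)
  also have "\<dots> = (\<Sum>i\<in>UNIV. (v $ i - t) * (\<rho> $ i - of_bool (i \<in> I)))"
    using zero by (simp add: left_diff_distrib sum_subtractf flip: sum_distrib_left)
  finally have eq: "v \<bullet> (\<rho> - (\<chi> i. of_bool (i \<in> I)))
      = (\<Sum>i\<in>UNIV. (v $ i - t) * (\<rho> $ i - of_bool (i \<in> I)))" .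
  \<comment> \<open>The two factors never have opposite signs, and the second is at least
    \<open>\<delta>\<close> in absolute value.\<close>
  have summand: "\<delta> * \<bar>v $ i - t\<bar> \<le> (v $ i - t) * (\<rho> $ i - of_bool (i \<in> I))" for i
  proof (cases "i \<in> I")
    case True
    then show ?thesis
      using mult_right_mono[OF \<delta>(3)[of i], of "t - v $ i"] t_in[of i] by (simp add: algebra_simps)
  next
    case False
    then show ?thesis
      using mult_right_mono[OF \<delta>(2)[of i], of "v $ i - t"] t_out[of i] by (simp add: algebra_simps)
  qed
  have nonneg: "0 \<le> (v $ i - t) * (\<rho> $ i - of_bool (i \<in> I))" for i
    using summand[of i] \<delta>(1) by (meson abs_ge_zero mult_nonneg_nonneg order_trans)
  have "\<delta> * \<bar>v $ j - t\<bar> \<le> v \<bullet> (\<rho> - (\<chi> i. of_bool (i \<in> I)))" for j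
    unfolding eq using summand[of j]
    by (rule order_trans) (rule member_le_sum[OF _ nonneg], simp_all)
  then show ?thesis
    using I by blast
qed

text \<open>The duality argument with the operators stripped away: \<open>S\<close> stands for the
  density-energy pairs of ensembles and \<open>h I\<close> for the energy of a Slater state.\<close>

lemma supporting_potential_exists:
  fixes S :: "((real ^ 'm::finite) \<times> real) set" and h :: "'m set \<Rightarrow> real"
  assumes "1 \<le> N" "N \<le> CARD('m)" and \<rho>: "\<rho> \<in> positive_densities N"
    and S: "compact S" "convex S"
    and slater_point: "\<And>I. card I = N \<Longrightarrow> (\<chi> i. of_bool (i \<in> I), h I) \<in> S"
    and sum_fst: "\<And>z. z \<in> S \<Longrightarrow> (\<Sum>i\<in>UNIV. fst z $ i) = real N"
  obtains v y where "(\<rho>, y) \<in> S" "\<And>z. z \<in> S \<Longrightarrow> y + v \<bullet> \<rho> \<le> snd z + v \<bullet> fst z"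
proof -
  obtain I0 :: "'m set" where "card I0 = N"
    using obtain_subset_with_card_n[OF assms(2)] by blast
  then have ne: "S \<noteq> {}"
    using slater_point by blast
  define L where "L v z = snd z + v \<bullet> (fst z - \<rho>)" for v and z :: "(real ^ 'm) \<times> real"
  have "\<exists>z\<in>S. \<forall>z'\<in>S. L v z \<le> L v z'" for v
    unfolding L_def by (rule continuous_attains_inf[OF S(1) ne]) (intro continuous_intros)
  then obtain m where m: "\<And>v. m v \<in> S" "\<And>v z. z \<in> S \<Longrightarrow> L v (m v) \<le> L v z"
    by metis
  define G where "G v = L v (m v)" for v
  have G_le: "G v \<le> L v z" if "z \<in> S" for v z
    using m that unfolding G_def by blast
  have "bounded (fst ` S)"
    using S(1) by (simp add: bounded_fst compact_imp_bounded)
  then obtain B where B: "\<And>z. z \<in> S \<Longrightarrow> norm (fst z) \<le> B"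
    unfolding bounded_iff by auto
  \<comment> \<open>Using the minimiser for \<open>v'\<close> as a competitor for \<open>v\<close>
    changes \<open>L\<close> only by a term linear in \<open>v - v'\<close>; \<open>S\<close> is
    bounded, so \<open>G\<close> is Lipschitz.\<close>
  have lip1: "G v \<le> G v' + (B + norm \<rho>) * dist v v'" for v v'
  proof -
    have "G v \<le> L v (m v')"
      using G_le m(1) .
    also have "\<dots> = G v' + (v - v') \<bullet> (fst (m v') - \<rho>)"
      unfolding G_def L_def by (simp add: inner_diff_left)
    also have "(v - v') \<bullet> (fst (m v') - \<rho>) \<le> norm (v - v') * norm (fst (m v') - \<rho>)"
      by (rule norm_cauchy_schwarz)
    also have "\<dots> \<le> dist v v' * (B + norm \<rho>)"
      unfolding dist_norm using B[OF m(1)[of v']] norm_triangle_ineq4[of "fst (m v')" \<rho>]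
      by (intro mult_left_mono) auto
    finally show ?thesis
      by (simp add: mult.commute)
  qed
  have "0 \<le> B + norm \<rho>"
    using B[OF m(1)[of 0]] norm_ge_zero[of "fst (m 0)"] norm_ge_zero[of \<rho>] by linarith
  moreover have "dist (G v) (G v') \<le> (B + norm \<rho>) * dist v v'" for v v'
    using lip1[of v v'] lip1[of v' v] by (simp add: dist_real_def abs_le_iff dist_commute)
  ultimately have "(B + norm \<rho>)-lipschitz_on UNIV G"
    unfolding lipschitz_on_def by blast
  then have cont: "continuous_on A G" for A
    using lipschitz_on_continuous_on continuous_on_subset by blast
  have sum_\<rho>: "(\<Sum>i\<in>UNIV. \<rho> $ i) = real N" and \<rho>_bounds: "\<And>i. 0 < \<rho> $ i" "\<And>i. \<rho> $ i < 1"
    using \<rho> unfolding positive_densities_def by auto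
  have shift: "L (v - (\<chi> i. t)) z = L v z" if "z \<in> S" for v t z
  proof -
    have "(\<chi> i. t) \<bullet> (fst z - \<rho>) = t * (\<Sum>i\<in>UNIV. fst z $ i - \<rho> $ i)"
      by (simp add: inner_vec_def sum_distrib_left)
    also have "\<dots> = 0"
      using sum_fst[OF that] sum_\<rho> by (simp add: sum_subtractf)
    finally show ?thesis
      unfolding L_def by (simp add: inner_diff_left)
  qed
  have G_shift: "G (v - (\<chi> i. t)) = G v" for v t
    using m shift unfolding G_def by (metis order_antisym)
  \<comment> \<open>The distance of \<open>\<rho>\<close> from the bounds 0 and 1; it is positive
    because there are finitely many sites.\<close>
  define \<delta> where "\<delta> = Min (range (\<lambda>i. min (\<rho> $ i) (1 - \<rho> $ i)))"
  have \<delta>_pos: "0 < \<delta>"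
    unfolding \<delta>_def using \<rho>_bounds by (subst Min_gr_iff) auto
  have "\<delta> \<le> min (\<rho> $ i) (1 - \<rho> $ i)" for i
    unfolding \<delta>_def by (rule Min_le) auto
  then have \<delta>_le: "\<And>i. \<delta> \<le> \<rho> $ i" "\<And>i. \<delta> \<le> 1 - \<rho> $ i"
    by auto
  define C where "C = Max (range h)"
  have C: "h I \<le> C" for I
    unfolding C_def by simp
  have coercive: "\<exists>t. \<forall>j. \<delta> * \<bar>v $ j - t\<bar> \<le> C - G v" for v
  proof -
    obtain I t where I: "card I = N"
      and t: "\<And>j. \<delta> * \<bar>v $ j - t\<bar> \<le> v \<bullet> (\<rho> - (\<chi> i. of_bool (i \<in> I)))"
      using lowest_sites_gap[OF assms(1,2) sum_\<rho> less_imp_le[OF \<delta>_pos] \<delta>_le, of v] by blast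
    have "G v \<le> h I - v \<bullet> (\<rho> - (\<chi> i. of_bool (i \<in> I)))"
      using G_le[OF slater_point[OF I], of v] by (simp add: L_def inner_diff_right)
    then have "\<delta> * \<bar>v $ j - t\<bar> \<le> C - G v" for j
      using t[of j] C[of I] by linarith
    then show ?thesis
      by blast
  qed
  \<comment> \<open>Chosen so that every \<open>v\<close> with \<open>G 0 \<le> G v\<close> has a
    constant shift in the box \<open>?K\<close>. A maximum over the box is then global.\<close>
  define R where "R = (C - G 0) / \<delta>"
  let ?K = "cbox (\<chi> i. - R) (\<chi> i. R) :: (real ^ 'm) set"
  have into_K: "\<exists>t. v - (\<chi> i. t) \<in> ?K" if "G 0 \<le> G v" for v
  proof -
    obtain t where t: "\<And>j. \<delta> * \<bar>v $ j - t\<bar> \<le> C - G v"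
      using coercive by blast
    have "\<bar>v $ j - t\<bar> \<le> R" for j
      unfolding R_def using t[of j] that \<delta>_pos by (simp add: pos_le_divide_eq mult.commute)
    then have "- R \<le> v $ j - t \<and> v $ j - t \<le> R" for j
      using abs_le_D1 abs_le_D2 by (metis minus_le_iff)
    then show ?thesis
      by (intro exI[of _ t]) (simp add: mem_box_cart)
  qed
  then have "?K \<noteq> {}"
    by blast
  then obtain v where v: "\<And>v'. v' \<in> ?K \<Longrightarrow> G v' \<le> G v"
    using continuous_attains_sup[OF compact_cbox _ cont] by blast
  have max: "G v' \<le> G v" for v'
  proof (cases "G 0 \<le> G v'")
    case True
    then show ?thesis
      using into_K v G_shift by metis
  next
    case False
    obtain t where "0 - (\<chi> i. t) \<in> ?K"
      using into_K by blast
    then have "G 0 \<le> G v"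
      using v G_shift by metis
    then show ?thesis
      using False by simp
  qed
  have "(\<rho>, G v) \<in> S"
  proof (rule ccontr)
    assume "(\<rho>, G v) \<notin> S"
    then obtain a b where ab: "a \<bullet> (\<rho>, G v) < b" "\<And>z. z \<in> S \<Longrightarrow> b < a \<bullet> z"
      using separating_hyperplane_closed_point[OF S(2) compact_imp_closed[OF S(1)]] by blast
    obtain w c where a: "a = (w, c)"
      by fastforce
    \<comment> \<open>As \<open>L v z - G v\<close> is nonnegative on \<open>S\<close>, raising its coefficient \<open>c\<close> to \<open>d > 0\<close>
      preserves the separation, which makes the hyperplane non-vertical.\<close>
    define d where "d = max c 1"
    define v' where "v' = v + (w - c *\<^sub>R v) /\<^sub>R d"
    have d: "0 < d" "c \<le> d"
      unfolding d_def by auto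
    let ?z = "m v'"
    have "L v' ?z = L v ?z + (v' - v) \<bullet> (fst ?z - \<rho>)"
      by (simp add: L_def inner_diff_left)
    moreover have "(w - c *\<^sub>R v) \<bullet> (fst ?z - \<rho>) = d * ((v' - v) \<bullet> (fst ?z - \<rho>))"
      using d by (simp add: v'_def)
    \<comment> \<open>\<open>v'\<close> is built for this identity: \<open>d\<close> times its
      difference from \<open>v\<close> is the part of the separating functional left after removing
      \<open>c\<close> times \<open>L v\<close>.\<close>
    ultimately have L_v': "(w - c *\<^sub>R v) \<bullet> (fst ?z - \<rho>) = d * (L v' ?z - L v ?z)"
      by simp
    have "0 < w \<bullet> (fst ?z - \<rho>) + c * (snd ?z - G v)"
      using ab(1) ab(2)[OF m(1)[of v']] unfolding a
      by (simp add: inner_prod_def algebra_simps inner_diff_right)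
    also have "\<dots> = (w - c *\<^sub>R v) \<bullet> (fst ?z - \<rho>) + c * (L v ?z - G v)"
      by (simp add: L_def inner_diff_left algebra_simps)
    also have "\<dots> \<le> (w - c *\<^sub>R v) \<bullet> (fst ?z - \<rho>) + d * (L v ?z - G v)"
      using d G_le[OF m(1)] by (simp add: mult_right_mono)
    also have "\<dots> = d * (L v' ?z - G v)"
      unfolding L_v' by (simp add: algebra_simps)
    finally have "G v < G v'"
      using d unfolding G_def by (simp add: zero_less_mult_iff)
    then show False
      using max[of v'] by simp
  qed
  moreover have "G v + v \<bullet> \<rho> \<le> snd z + v \<bullet> fst z" if "z \<in> S" for z
    using G_le[OF that, of v] by (simp add: L_def inner_diff_right)
  ultimately show thesis
    using that by blast
qed

section \<open>Self-adjoint operators on a sector\<close>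

lemma fock_inner_cnj: "cnj (fock_inner \<phi> \<psi>) = fock_inner \<psi> \<phi>"
  by (simp add: fock_inner_def mult.commute)

lemma fock_inner_add_right: "fock_inner \<phi> (\<psi> + \<eta>) = fock_inner \<phi> \<psi> + fock_inner \<phi> \<eta>"
  by (simp add: fock_inner_def sum.distrib distrib_left)

lemma fock_inner_add_left: "fock_inner (\<phi> + \<psi>) \<eta> = fock_inner \<phi> \<eta> + fock_inner \<psi> \<eta>"
  by (simp add: fock_inner_def sum.distrib distrib_right)

lemma fock_inner_scale_right: "fock_inner \<phi> (c *s \<psi>) = c * fock_inner \<phi> \<psi>"
  by (simp add: fock_inner_def sum_distrib_left mult.left_commute)

lemma fock_inner_scale_left: "fock_inner (c *s \<phi>) \<psi> = cnj c * fock_inner \<phi> \<psi>"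
  by (simp add: fock_inner_def sum_distrib_left mult.assoc)

lemma fock_inner_sum_right: "fock_inner \<phi> (\<Sum>s\<in>T. f s) = (\<Sum>s\<in>T. fock_inner \<phi> (f s))"
  by (induction T rule: infinite_finite_induct)
    (simp_all add: fock_inner_add_right, simp_all add: fock_inner_def)

lemma fock_inner_sum_left: "fock_inner (\<Sum>s\<in>T. f s) \<phi> = (\<Sum>s\<in>T. fock_inner (f s) \<phi>)"
  by (metis (no_types, lifting) fock_inner_cnj fock_inner_sum_right cnj_sum sum.cong)

lemma fock_inner_slater_left: "fock_inner (slater I) \<phi> = \<phi> $ I"
  unfolding fock_inner_def slater_def axis_def
  by (simp add: if_distrib[of cnj] if_distrib[of "\<lambda>x. x * _"] cong: if_cong)

text \<open>Links the complex inner product to the real one, in which norms, convexity and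
  separation are expressed.\<close>

lemma Re_fock_inner: "Re (fock_inner \<phi> \<psi>) = \<phi> \<bullet> \<psi>"
  by (simp add: fock_inner_def inner_vec_def inner_complex_def)

lemma scale_of_real: "complex_of_real r *s \<psi> = r *\<^sub>R \<psi>"
  by (simp add: vec_eq_iff scaleR_conv_of_real[where 'a = complex])

lemma sector_add: "\<phi> \<in> sector N \<Longrightarrow> \<psi> \<in> sector N \<Longrightarrow> \<phi> + \<psi> \<in> sector N"
  by (simp add: sector_def)

lemma sector_scale: "\<psi> \<in> sector N \<Longrightarrow> c *s \<psi> \<in> sector N"
  by (simp add: sector_def)

lemma sector_scaleR: "\<psi> \<in> sector N \<Longrightarrow> c *\<^sub>R \<psi> \<in> sector N"
  by (simp add: sector_def)

lemma sector_sum: "(\<And>s. s \<in> T \<Longrightarrow> f s \<in> sector N) \<Longrightarrow> (\<Sum>s\<in>T. f s) \<in> sector N"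
  by (simp add: sector_def)

lemma slater_in_sector: "card I = N \<Longrightarrow> slater I \<in> sector N"
  by (auto simp: sector_def slater_def axis_def)

lemma norm_slater: "norm (slater I) = 1"
  by (simp add: slater_def)

lemma closed_sector: "closed (sector N :: 'm::finite fock set)"
proof -
  have "(sector N :: 'm fock set) = (\<Inter>I\<in>{I. card I \<noteq> N}. {\<psi>. \<psi> $ I = 0})"
    by (auto simp: sector_def)
  then show ?thesis
    by (simp add: closed_INT closed_Collect_eq continuous_on_component)
qed

section \<open>Self-adjointness and diagonal operators\<close>

lemma selfadjoint_onD:
  assumes "selfadjoint_on N A"
  shows "\<And>\<psi>. \<psi> \<in> sector N \<Longrightarrow> A \<psi> \<in> sector N"
    and "\<And>\<phi> \<psi>. \<phi> \<in> sector N \<Longrightarrow> \<psi> \<in> sector N \<Longrightarrow> A (\<phi> + \<psi>) = A \<phi> + A \<psi>"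
    and "\<And>c \<psi>. \<psi> \<in> sector N \<Longrightarrow> A (c *s \<psi>) = c *s A \<psi>"
    and "\<And>\<phi> \<psi>. \<phi> \<in> sector N \<Longrightarrow> \<psi> \<in> sector N \<Longrightarrow> fock_inner \<phi> (A \<psi>) = fock_inner (A \<phi>) \<psi>"
  using assms unfolding selfadjoint_on_def operator_on_def by auto

lemma selfadjoint_onI:
  assumes "\<And>\<psi>. \<psi> \<in> sector N \<Longrightarrow> A \<psi> \<in> sector N"
    and "\<And>\<phi> \<psi>. \<phi> \<in> sector N \<Longrightarrow> \<psi> \<in> sector N \<Longrightarrow> A (\<phi> + \<psi>) = A \<phi> + A \<psi>"
    and "\<And>c \<psi>. \<psi> \<in> sector N \<Longrightarrow> A (c *s \<psi>) = c *s A \<psi>"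
    and "\<And>\<phi> \<psi>. \<phi> \<in> sector N \<Longrightarrow> \<psi> \<in> sector N \<Longrightarrow> fock_inner \<phi> (A \<psi>) = fock_inner (A \<phi>) \<psi>"
  shows "selfadjoint_on N A"
  using assms unfolding selfadjoint_on_def operator_on_def by auto

lemma selfadjoint_on_diagonal:
  fixes A :: "'m::finite fock \<Rightarrow> 'm fock" and d :: "'m set \<Rightarrow> real"
  assumes "\<And>\<psi> I. A \<psi> $ I = complex_of_real (d I) * \<psi> $ I"
  shows "selfadjoint_on N A"
  by (rule selfadjoint_onI)
    (simp_all add: sector_def fock_inner_def vec_eq_iff assms distrib_left mult.left_commute mult.assoc)

lemma selfadjoint_on_id: "selfadjoint_on N id"
  by (rule selfadjoint_on_diagonal[where d = "\<lambda>_. 1"]) simp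

lemma selfadjoint_on_number_op: "selfadjoint_on N (number_op i)"
  by (rule selfadjoint_on_diagonal[where d = "\<lambda>I. of_bool (i \<in> I)"]) (simp add: number_op_nth)

lemma potential_nth: "potential v \<psi> $ I = complex_of_real (\<Sum>i\<in>I. v $ i) * \<psi> $ I"
proof -
  have "potential v \<psi> $ I = (\<Sum>i\<in>UNIV. if i \<in> I then complex_of_real (v $ i) * \<psi> $ I else 0)"
    unfolding potential_def by (auto simp: number_op_nth intro!: sum.cong)
  also have "\<dots> = (\<Sum>i\<in>I. complex_of_real (v $ i) * \<psi> $ I)"
    by (simp add: sum.If_cases)
  finally show ?thesis
    by (simp add: sum_distrib_right)
qed

lemma selfadjoint_on_add_potential:
  assumes "selfadjoint_on N H"
  shows "selfadjoint_on N (\<lambda>\<psi>. H \<psi> + potential v \<psi>)"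
proof -
  note H = selfadjoint_onD[OF assms]
  note V = selfadjoint_onD[OF selfadjoint_on_diagonal[of "potential v", OF potential_nth]]
  show ?thesis
    by (rule selfadjoint_onI)
      (simp_all add: H V sector_add fock_inner_add_left fock_inner_add_right vector_add_ldistrib)
qed

text \<open>The potential energy of a state depends on the state only through its density, and
  linearly so.\<close>

lemma inner_potential: "\<psi> \<bullet> potential v \<psi> = v \<bullet> (\<chi> i. \<psi> \<bullet> number_op i \<psi>)"
  unfolding potential_def by (simp add: inner_sum_right scale_of_real inner_vec_def[of v])

section \<open>Quadratic forms and the variational principle\<close>

lemma fock_inner_selfadjoint:
  assumes "selfadjoint_on N A" "\<psi> \<in> sector N"
  shows "fock_inner \<psi> (A \<psi>) = complex_of_real (\<psi> \<bullet> A \<psi>)"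
proof -
  have "cnj (fock_inner \<psi> (A \<psi>)) = fock_inner \<psi> (A \<psi>)"
    unfolding fock_inner_cnj using selfadjoint_onD(4)[OF assms(1)] assms(2) by simp
  then have "Im (fock_inner \<psi> (A \<psi>)) = 0"
    by (metis Reals_cnj_iff complex_is_Real_iff)
  then show ?thesis
    by (simp add: complex_eq_iff Re_fock_inner)
qed

text \<open>\<open>A\<close> is linear only on the sector. Composing it with the coordinate
  projection \<open>P\<close> gives a linear map on the whole finite-dimensional space that agrees
  with \<open>A\<close> on the sector.\<close>

lemma continuous_on_selfadjoint:
  fixes A :: "'m::finite fock \<Rightarrow> 'm fock"
  assumes "selfadjoint_on N A"
  shows "continuous_on (sector N) A"
proof -
  define P :: "'m fock \<Rightarrow> 'm fock" where "P \<psi> = (\<chi> I. if card I = N then \<psi> $ I else 0)" for \<psi>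
  have P: "P \<psi> \<in> sector N" for \<psi>
    by (simp add: P_def sector_def)
  have "linear (A \<circ> P)"
  proof (rule linearI)
    fix \<phi> \<psi> :: "'m fock" and r :: real
    have "P (\<phi> + \<psi>) = P \<phi> + P \<psi>" "P (r *\<^sub>R \<psi>) = complex_of_real r *s P \<psi>"
      by (simp_all add: P_def vec_eq_iff scaleR_conv_of_real[where 'a = complex])
    then show "(A \<circ> P) (\<phi> + \<psi>) = (A \<circ> P) \<phi> + (A \<circ> P) \<psi>" "(A \<circ> P) (r *\<^sub>R \<psi>) = r *\<^sub>R (A \<circ> P) \<psi>"
      by (simp_all add: selfadjoint_onD(2,3)[OF assms] P, simp add: scale_of_real)
  qed
  then have "continuous_on (sector N) (A \<circ> P)"
    by (intro linear_continuous_on) (simp only: linear_conv_bounded_linear)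
  moreover have "P \<psi> = \<psi>" if "\<psi> \<in> sector N" for \<psi>
    using that by (auto simp: P_def sector_def vec_eq_iff)
  ultimately show ?thesis
    by (simp cong: continuous_on_cong)
qed

text \<open>First variation: moving \<open>\<psi>\<close> along the residual \<open>\<phi>\<close>
  changes the nonnegative form
  \<open>\<eta> \<bullet> A \<eta> - E * (\<eta> \<bullet> \<eta>)\<close> at first order by twice
  the squared norm of \<open>\<phi>\<close>, so the residual must vanish.\<close>

lemma rayleigh_minimiser_eigenvector:
  assumes A: "selfadjoint_on N A" and \<psi>: "\<psi> \<in> sector N" "\<psi> \<bullet> A \<psi> = E * (\<psi> \<bullet> \<psi>)"
    and bound: "\<And>\<eta>. \<eta> \<in> sector N \<Longrightarrow> E * (\<eta> \<bullet> \<eta>) \<le> \<eta> \<bullet> A \<eta>"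
  shows "A \<psi> = complex_of_real E *s \<psi>"
proof -
  note A' = selfadjoint_onD[OF A]
  define \<phi> where "\<phi> = A \<psi> - E *\<^sub>R \<psi>"
  have "\<phi> = A \<psi> + (- E) *\<^sub>R \<psi>"
    by (simp add: \<phi>_def)
  then have \<phi>: "\<phi> \<in> sector N"
    by (simp only: sector_add A' \<psi> sector_scaleR)
  have sym: "\<psi> \<bullet> A \<phi> = \<phi> \<bullet> A \<psi>"
    using A'(4)[OF \<psi>(1) \<phi>] by (metis Re_fock_inner inner_commute)
  define q where "q = \<phi> \<bullet> A \<phi> - E * (\<phi> \<bullet> \<phi>)"
  have ineq: "0 \<le> t * (2 * (\<phi> \<bullet> \<phi>) + t * q)" for t
  proof -
    have At: "A (t *\<^sub>R \<phi>) = t *\<^sub>R A \<phi>"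
      using A'(3)[OF \<phi>, of "complex_of_real t"] by (simp only: scale_of_real)
    have "0 \<le> (\<psi> + t *\<^sub>R \<phi>) \<bullet> A (\<psi> + t *\<^sub>R \<phi>) - E * ((\<psi> + t *\<^sub>R \<phi>) \<bullet> (\<psi> + t *\<^sub>R \<phi>))"
      using bound[OF sector_add[OF \<psi>(1) sector_scaleR[OF \<phi>]], of t] by simp
    also have "\<dots> = 2 * t * (\<phi> \<bullet> A \<psi> - E * (\<phi> \<bullet> \<psi>)) + t * t * q"
      using A'(2)[OF \<psi>(1) sector_scaleR[OF \<phi>], of t] At \<psi>(2) sym
      by (simp add: q_def inner_add_left inner_add_right inner_commute[of \<psi> \<phi>] algebra_simps)
    also have "\<phi> \<bullet> A \<psi> - E * (\<phi> \<bullet> \<psi>) = \<phi> \<bullet> \<phi>"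
      by (subst (4) \<phi>_def) (simp add: inner_diff_right)
    finally show ?thesis
      by (simp add: algebra_simps)
  qed
  have "\<phi> = 0"
  proof (rule ccontr)
    assume "\<phi> \<noteq> 0"
    then have p: "0 < \<phi> \<bullet> \<phi>"
      by simp
    \<comment> \<open>Negative, and so small that the term \<open>t * q\<close> is at most
      \<open>\<phi> \<bullet> \<phi>\<close> in absolute value; the bracket in \<open>ineq\<close>
      stays positive.\<close>
    define t where "t = - (\<phi> \<bullet> \<phi>) / (\<bar>q\<bar> + 1)"
    have "t < 0"
      using p by (simp add: t_def divide_neg_pos)
    have "- t * q \<le> - t * (\<bar>q\<bar> + 1)"
      using \<open>t < 0\<close> by (intro mult_left_mono) auto
    also have "\<dots> = \<phi> \<bullet> \<phi>"
      by (simp add: t_def)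
    finally have "0 < 2 * (\<phi> \<bullet> \<phi>) + t * q"
      using p by linarith
    then show False
      using ineq[of t] \<open>t < 0\<close> by (smt (verit) mult_neg_pos)
  qed
  then show ?thesis
    by (simp add: \<phi>_def scale_of_real)
qed

section \<open>Ensembles of pure states\<close>

text \<open>In bra-ket notation, the mixture of the projectors |f s><f s| with weights
  \<open>u s\<close>, for unit vectors \<open>f s\<close>.\<close>

definition ensemble :: "'s set \<Rightarrow> ('s \<Rightarrow> real) \<Rightarrow> ('s \<Rightarrow> 'm::finite fock) \<Rightarrow> 'm fock \<Rightarrow> 'm fock"
  where "ensemble T u f \<phi> = (\<Sum>s\<in>T. (complex_of_real (u s) * fock_inner (f s) \<phi>) *s f s)"

lemma fock_inner_ensemble:
  "fock_inner \<phi> (ensemble T u f \<psi>)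
    = (\<Sum>s\<in>T. complex_of_real (u s) * fock_inner (f s) \<psi> * fock_inner \<phi> (f s))"
  by (simp add: ensemble_def fock_inner_sum_right fock_inner_scale_right)

lemma positive_on_ensemble:
  assumes f: "\<And>s. s \<in> T \<Longrightarrow> f s \<in> sector N" and u: "\<And>s. s \<in> T \<Longrightarrow> 0 \<le> u s"
  shows "positive_on N (ensemble T u f)"
  unfolding positive_on_def
proof (intro conjI ballI)
  show "selfadjoint_on N (ensemble T u f)"
  proof (rule selfadjoint_onI)
    show "fock_inner \<phi> (ensemble T u f \<psi>) = fock_inner (ensemble T u f \<phi>) \<psi>" for \<phi> \<psi>
      unfolding fock_inner_ensemble
      by (simp add: ensemble_def fock_inner_sum_left fock_inner_scale_left fock_inner_cnj mult_ac)
    show "ensemble T u f \<psi> \<in> sector N" for \<psi>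
      unfolding ensemble_def by (intro sector_sum sector_scale f)
    show "ensemble T u f (\<phi> + \<psi>) = ensemble T u f \<phi> + ensemble T u f \<psi>" for \<phi> \<psi>
      by (simp add: ensemble_def fock_inner_add_right vec_eq_iff algebra_simps sum.distrib)
    show "ensemble T u f (c *s \<psi>) = c *s ensemble T u f \<psi>" for c \<psi>
      by (simp add: ensemble_def fock_inner_scale_right vec_eq_iff sum_distrib_left mult_ac)
  qed
  fix \<psi>
  have "complex_of_real (u s) * fock_inner (f s) \<psi> * fock_inner \<psi> (f s)
      = complex_of_real (u s * (cmod (fock_inner (f s) \<psi>))\<^sup>2)" for s
    by (simp only: fock_inner_cnj[of "f s" \<psi>, symmetric] complex_norm_square mult.assoc of_real_mult)
  then have "fock_inner \<psi> (ensemble T u f \<psi>)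
      = complex_of_real (\<Sum>s\<in>T. u s * (cmod (fock_inner (f s) \<psi>))\<^sup>2)"
    unfolding fock_inner_ensemble of_real_sum by (simp only:)
  then show "0 \<le> Re (fock_inner \<psi> (ensemble T u f \<psi>))"
    using u by (simp add: sum_nonneg)
qed

text \<open>Moving \<open>A\<close> to the other side of the inner product and expanding in the
  Slater basis turns the trace of each pure term into its expectation value.\<close>

lemma trace_on_ensemble:
  assumes f: "\<And>s. s \<in> T \<Longrightarrow> f s \<in> sector N" and A: "selfadjoint_on N A"
  shows "trace_on N (ensemble T u f \<circ> A) = complex_of_real (\<Sum>s\<in>T. u s * (f s \<bullet> A (f s)))"
proof -
  have pure: "(\<Sum>I | card I = N. fock_inner \<psi> (A (slater I)) * \<psi> $ I) = complex_of_real (\<psi> \<bullet> A \<psi>)"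
    if \<psi>: "\<psi> \<in> sector N" for \<psi>
  proof -
    have "(\<Sum>I | card I = N. fock_inner \<psi> (A (slater I)) * \<psi> $ I)
        = (\<Sum>I | card I = N. cnj (A \<psi> $ I) * \<psi> $ I)"
    proof (rule sum.cong)
      fix I assume "I \<in> {I :: 'b set. card I = N}"
      then have "fock_inner \<psi> (A (slater I)) = fock_inner (A \<psi>) (slater I)"
        using selfadjoint_onD(4)[OF A \<psi> slater_in_sector] by simp
      also have "\<dots> = cnj (A \<psi> $ I)"
        by (metis fock_inner_cnj fock_inner_slater_left)
      finally show "fock_inner \<psi> (A (slater I)) * \<psi> $ I = cnj (A \<psi> $ I) * \<psi> $ I"
        by simp
    qed simp
    \<comment> \<open>The missing index sets contribute nothing, as \<open>\<psi>\<close> vanishes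
      there.\<close>
    also have "\<dots> = fock_inner (A \<psi>) \<psi>"
      unfolding fock_inner_def using \<psi> by (intro sum.mono_neutral_left) (auto simp: sector_def)
    finally show ?thesis
      using selfadjoint_onD(4)[OF A \<psi> \<psi>] fock_inner_selfadjoint[OF A \<psi>] by simp
  qed
  have "trace_on N (ensemble T u f \<circ> A)
      = (\<Sum>I | card I = N. \<Sum>s\<in>T. complex_of_real (u s) * (fock_inner (f s) (A (slater I)) * f s $ I))"
    by (simp add: trace_on_def fock_inner_ensemble fock_inner_slater_left mult.assoc)
  also have "\<dots> = (\<Sum>s\<in>T. complex_of_real (u s)
      * (\<Sum>I | card I = N. fock_inner (f s) (A (slater I)) * f s $ I))"
    unfolding sum_distrib_left by (rule sum.swap)
  finally show ?thesis
    by (simp add: pure f)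
qed

text \<open>The total number operator is the potential with all values 1, which acts on the sector
  as multiplication by \<open>N\<close>.\<close>

lemma sum_inner_number_op:
  assumes "\<psi> \<in> sector N"
  shows "(\<Sum>i\<in>UNIV. \<psi> \<bullet> number_op i \<psi>) = real N * (\<psi> \<bullet> \<psi>)"
proof -
  have "(\<Sum>i\<in>UNIV. \<psi> \<bullet> number_op i \<psi>) = \<psi> \<bullet> potential (\<chi> i. 1) \<psi>"
    by (simp add: inner_potential inner_vec_def[of "\<chi> i. 1"])
  also have "potential (\<chi> i. 1) \<psi> = real N *\<^sub>R \<psi>"
    using assms by (auto simp: vec_eq_iff potential_nth sector_def scaleR_conv_of_real[where 'a = complex])
  finally show ?thesis
    by simp
qed

section \<open>The potential and its ground-state ensemble\<close>

theorem theorem19: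
  fixes H0 :: "'m::{finite,linorder} fock \<Rightarrow> 'm fock"
    and N :: nat
    and \<rho> :: "real ^ 'm::{finite,linorder}"
  assumes "1 \<le> N" and "N < CARD('m)"
    and "selfadjoint_on N H0"
    and "\<rho> \<in> positive_densities N"
  shows "\<exists>v  :: real ^ 'm::{finite,linorder}. \<exists>\<Gamma> :: 'm fock \<Rightarrow> 'm fock.
    ground_state_ensemble N (\<lambda>\<psi>. H0 \<psi> + potential v \<psi>) \<Gamma> \<and> has_density N \<Gamma> \<rho>"
proof -
  define K :: "'m::{finite,linorder} fock set" where "K = sphere 0 1 \<inter> sector N"
  define p :: "'m fock \<Rightarrow> (real ^ 'm::{finite,linorder}) \<times> real"
    where "p \<psi> = (\<chi> i. \<psi> \<bullet> number_op i \<psi>, \<psi> \<bullet> H0 \<psi>)" for \<psi>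
  have K: "\<psi> \<in> sector N" "\<psi> \<bullet> \<psi> = 1" if "\<psi> \<in> K" for \<psi>
    using that by (auto simp: K_def norm_eq_1)
  have "compact K"
    unfolding K_def by (intro compact_Int_closed compact_sphere closed_sector)
  moreover have "continuous_on K p"
    unfolding p_def
    by (intro continuous_intros continuous_on_vec_lambda
        continuous_on_subset[OF continuous_on_selfadjoint[OF assms(3)]]
        continuous_on_subset[OF continuous_on_selfadjoint[OF selfadjoint_on_number_op[of N]]])
      (auto simp: K_def)
  ultimately have compact: "compact (convex hull (p ` K))"
    by (intro compact_convex_hull compact_continuous_image)
  have slater_point: "(\<chi> i. of_bool (i \<in> I), slater I \<bullet> H0 (slater I)) \<in> convex hull (p ` K)"
    if "card I = N" for I
  proof -
    have "slater I \<in> K"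
      using that by (simp add: K_def slater_in_sector norm_slater)
    moreover have "slater I \<bullet> number_op i (slater I) = of_bool (i \<in> I)" for i
      by (simp add: number_op_slater dot_square_norm norm_slater)
    ultimately show ?thesis
      by (intro hull_inc image_eqI[of _ _ "slater I"]) (simp_all add: p_def)
  qed
  \<comment> \<open>Fixed particle number is a linear condition on the density, so it passes to the
    convex hull.\<close>
  have "p ` K \<subseteq> {z. (\<chi> i. 1, 0) \<bullet> z = real N}"
    using K sum_inner_number_op[OF K(1)] by (auto simp: p_def inner_prod_def inner_vec_def[of "\<chi> i. 1"])
  then have "convex hull (p ` K) \<subseteq> {z. (\<chi> i. 1, 0) \<bullet> z = real N}"
    by (rule hull_minimal) (rule convex_hyperplane)
  then have sum_fst: "(\<Sum>i\<in>UNIV. fst z $ i) = real N" if "z \<in> convex hull (p ` K)" for z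
    using that by (auto simp: inner_prod_def inner_vec_def[of "\<chi> i. 1"])
  obtain v y where in_hull: "(\<rho>, y) \<in> convex hull (p ` K)"
    and min: "\<And>z. z \<in> convex hull (p ` K) \<Longrightarrow> y + v \<bullet> \<rho> \<le> snd z + v \<bullet> fst z"
    using supporting_potential_exists[OF assms(1) less_imp_le[OF assms(2)] assms(4) compact
        convex_convex_hull slater_point sum_fst] by blast
  define H where "H \<psi> = H0 \<psi> + potential v \<psi>" for \<psi>
  define E where "E = y + v \<bullet> \<rho>"
  have H: "selfadjoint_on N H"
    unfolding H_def using selfadjoint_on_add_potential[OF assms(3)] .
  \<comment> \<open>The energy under \<open>H\<close> is a linear functional of
    \<open>p \<psi>\<close>, so bounds on the hull become bounds on energies.\<close>
  have energy: "\<psi> \<bullet> H \<psi> = (v, 1) \<bullet> p \<psi>" for \<psi>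
    by (simp add: H_def p_def inner_add_right inner_potential inner_prod_def)
  have E_le: "E \<le> \<psi> \<bullet> H \<psi>" if "\<psi> \<in> K" for \<psi>
    using min[OF hull_inc[OF imageI[OF that]]] by (simp add: E_def energy inner_prod_def)
  \<comment> \<open>Both sides are homogeneous of degree two, which reduces the claim to unit
    vectors.\<close>
  have bound: "E * (\<eta> \<bullet> \<eta>) \<le> \<eta> \<bullet> H \<eta>" if \<eta>: "\<eta> \<in> sector N" for \<eta>
  proof (cases "\<eta> = 0")
    case False
    define \<psi> where "\<psi> = \<eta> /\<^sub>R norm \<eta>"
    have "\<psi> \<in> K"
      using \<eta> False by (simp add: K_def \<psi>_def sector_scaleR)
    moreover have "\<eta> = norm \<eta> *\<^sub>R \<psi>"
      using False by (simp add: \<psi>_def)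
    then have "H \<eta> = norm \<eta> *\<^sub>R H \<psi>"
      using selfadjoint_onD(3)[OF H K(1)[OF \<open>\<psi> \<in> K\<close>], of "complex_of_real (norm \<eta>)"]
      by (simp only: scale_of_real)
    then have "\<eta> \<bullet> H \<eta> = (norm \<eta>)\<^sup>2 * (\<psi> \<bullet> H \<psi>)"
      using \<open>\<eta> = norm \<eta> *\<^sub>R \<psi>\<close>
      by (metis inner_scaleR_left inner_scaleR_right mult.assoc power2_eq_square)
    ultimately show ?thesis
      using E_le[of \<psi>] by (simp add: dot_square_norm mult.commute[of E] mult_left_mono)
  qed simp
  \<comment> \<open>The functional equals \<open>E\<close> at the hull point
    \<open>(\<rho>, y)\<close>. If it exceeded \<open>E\<close> at all pure states, the hull would
    lie in an open half-space missing that point.\<close>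
  obtain \<psi> where "\<psi> \<in> K" and "\<psi> \<bullet> H \<psi> \<le> E"
  proof (rule ccontr)
    assume "\<not> thesis"
    then have "p ` K \<subseteq> {z. (v, 1) \<bullet> z > E}"
      using that energy by fastforce
    then have "convex hull (p ` K) \<subseteq> {z. (v, 1) \<bullet> z > E}"
      by (rule hull_minimal) (rule convex_halfspace_gt)
    then show False
      using in_hull by (auto simp: E_def)
  qed
  then have "H \<psi> = complex_of_real E *s \<psi>"
    using E_le[of \<psi>] K[of \<psi>] by (intro rayleigh_minimiser_eigenvector[OF H _ _ bound]) auto
  then have "eigenvalue_on N H (complex_of_real E)"
    unfolding eigenvalue_on_def using K[OF \<open>\<psi> \<in> K\<close>] by (intro bexI[of _ \<psi>]) auto
  moreover have "E \<le> \<mu>" if ev: "eigenvalue_on N H (complex_of_real \<mu>)" for \<mu>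
  proof -
    obtain \<eta> where "\<eta> \<in> sector N" "\<eta> \<noteq> 0" "H \<eta> = \<mu> *\<^sub>R \<eta>"
      using ev unfolding eigenvalue_on_def scale_of_real by blast
    then show ?thesis
      using bound[of \<eta>] by simp
  qed
  ultimately have smallest: "smallest_eigenvalue_on N H E"
    unfolding smallest_eigenvalue_on_def by blast
  obtain T u where "finite T" and T: "T \<subseteq> p ` K" and u: "\<And>z. z \<in> T \<Longrightarrow> 0 \<le> u z" "sum u T = 1"
    and comb: "(\<Sum>z\<in>T. u z *\<^sub>R z) = (\<rho>, y)"
    using in_hull unfolding convex_hull_explicit by blast
  \<comment> \<open>\<open>p\<close> need not be injective, so a pure state is chosen for each point
    of the convex combination.\<close>
  define f where "f = inv_into K p"
  have f: "f z \<in> K" "p (f z) = z" if "z \<in> T" for z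
    using T that unfolding f_def by (auto intro: inv_into_into f_inv_into_f)
  define \<Gamma> where "\<Gamma> = ensemble T u f"
  have trace: "trace_on N (\<Gamma> \<circ> A) = complex_of_real (\<Sum>z\<in>T. u z * (f z \<bullet> A (f z)))"
    if "selfadjoint_on N A" for A
    unfolding \<Gamma>_def using that f K by (intro trace_on_ensemble) auto
  have "positive_on N \<Gamma>"
    unfolding \<Gamma>_def using u f K by (intro positive_on_ensemble) auto
  moreover have "trace_on N \<Gamma> = 1"
    using trace[OF selfadjoint_on_id] u(2) f K by simp
  moreover have "trace_on N (\<Gamma> \<circ> H) = complex_of_real E"
  proof -
    \<comment> \<open>By linearity the mixture has the energy of the combined point
      \<open>(\<rho>, y)\<close>.\<close>
    have "(\<Sum>z\<in>T. u z * (f z \<bullet> H (f z))) = (v, 1) \<bullet> (\<Sum>z\<in>T. u z *\<^sub>R z)"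
      by (simp add: inner_sum_right energy f)
    also have "\<dots> = E"
      by (simp add: comb E_def)
    finally show ?thesis
      by (simp only: trace[OF H])
  qed
  ultimately have "ground_state_ensemble N H \<Gamma>"
    unfolding ground_state_ensemble_def using smallest by blast
  moreover have "has_density N \<Gamma> \<rho>"
    unfolding has_density_def
  proof
    fix i
    have "f z \<bullet> number_op i (f z) = fst z $ i" if "z \<in> T" for z
      using arg_cong[OF f(2)[OF that], of "\<lambda>z. fst z $ i"] by (simp add: p_def)
    then have "(\<Sum>z\<in>T. u z * (f z \<bullet> number_op i (f z))) = fst (\<Sum>z\<in>T. u z *\<^sub>R z) $ i"
      by (simp add: fst_sum)
    then show "trace_on N (\<Gamma> \<circ> number_op i) = complex_of_real (\<rho> $ i)"
      by (simp only: trace[OF selfadjoint_on_number_op] comb fst_conv)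
  qed
  ultimately show ?thesis
    unfolding H_def by blast
qed

end
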